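(* Let $\mu,\mu'$ be probability measures on $\mathbb Z$ with supports $S_\mu\subset\mathbb Z^+$, $S_{\mu'}\subset\mathbb Z^-$ and with $\gcd(S_\mu)=\gcd(S_{\mu'})=1$. Let $H(n)=\mu\,]n,+\infty[$ and $H'(-n)=\mu'\,]-\infty,-n[$ for $n\ge0$, and let $\rho$ be the measure on $\mathbb Z$ given by $$\rho(n)=\begin{cases}\displaystyle\sum_{k=1}^{+\infty}\mu(k)\,\mu'[n-k+1,n] & \text{if } n\le-1,\\[2mm] \displaystyle\sum_{k=1}^{+\infty}\mu'(-k)\,\mu[n+1,n+k] & \text{if } n\ge0.\end{cases}$$ Then the total mass of $\rho$ on $\mathcal I_{\mathbf C}(0)$ is finite if and only if $$\sum_{n=0}^{+\infty}H(n)\,H'(-n)<+\infty.$$ In this case, the crossing sub-process $\mathcal X_{\mathbf C}^{(0)}$ is positive recurrent (on $\mathcal I_{\mathbf C}(0)$) and $\mathcal X^{(0)}(\mu,\mu')$ is recurrent on its essential class.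
   Context: $\mathbb Z^+$ (resp. $\mathbb Z^-$) is the set of positive (resp. negative) integers. For a measure $m$ on $\mathbb Z$, $m[a,b]=\sum_{j=a}^bm(j)$. $D=\max S_\mu$ (possibly $+\infty$), $D'=\min S_{\mu'}$ (possibly $-\infty$). The oscillating random walk $\mathcal X^{(0)}(\mu,\mu')=(X_n^{(0)})_{n\ge0}$ is the Markov chain on $\mathbb Z$ with $X_{n+1}^{(0)}=X_n^{(0)}+\xi_{n+1}$ if $X_n^{(0)}\le-1$ and $X_{n+1}^{(0)}=X_n^{(0)}+\xi'_{n+1}$ if $X_n^{(0)}\ge0$, where $(\xi_n,\xi_n')_{n\ge1}$ is i.i.d., $\xi_n$ has law $\mu$ and $\xi'_n$ has law $\mu'$. The crossing times are $C_0=0$ and $C_{k+1}=\inf\{n>C_k: X_n^{(0)}\ge0\}$ if $X_{C_k}^{(0)}\le-1$, $C_{k+1}=\inf\{n>C_k:X_n^{(0)}<0\}$ if $X_{C_k}^{(0)}\ge0$; they are a.s. finite. The crossing sub-process is the Markov chain $\mathcal X^{(0)}_{\mathbf C}=(X_{C_k}^{(0)})_{k\ge0}$. Since $\gcd(S_\mu)=\gcd(S_{\mu'})=1$, $\mathcal X^{(0)}$ has a unique essential (closed irreducible) class $\mathcal I(0)=\{y\in\mathbb Z:D'\le y\le D-1\}$, the irreducible class of $0$. Put $\mathcal I^+(0)=\{y\in\mathcal I(0):y\ge0\}$, $\mathcal I^-(0)=\{y\in\mathcal I(0):y\le-1\}$ and $\mathcal I_{\mathbf C}(0)=\{y\in\mathcal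 I^+(0):(y-S_\mu)\cap\mathcal I^-(0)\neq\emptyset\}\cup\{y\in\mathcal I^-(0):(y-S_{\mu'})\cap\mathcal I^+(0)\neq\emptyset\}$, an essential class of $\mathcal X_{\mathbf C}^{(0)}$. *)

theory Defs
  imports "HOL-Probability.Probability"
begin

subsection \<open>The oscillating random walk and its crossing sub-process\<close>

text \<open>
  \<open>osc_walk \<xi> \<xi>' x\<close> is the walk started at \<open>x\<close> and driven by the increments
  \<open>\<xi> n\<close>, \<open>\<xi>' n\<close> for \<open>n \<ge> 1\<close>; the values \<open>\<xi> 0\<close> and \<open>\<xi>' 0\<close> are never used.
\<close>

primrec osc_walk ::
  "(nat \<Rightarrow> 'w \<Rightarrow> int) \<Rightarrow> (nat \<Rightarrow> 'w \<Rightarrow> int) \<Rightarrow> int \<Rightarrow> nat \<Rightarrow> 'w \<Rightarrow> int"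
where
  "osc_walk \<xi> \<xi>' x 0 \<omega> = x"
| "osc_walk \<xi> \<xi>' x (Suc n) \<omega> =
     osc_walk \<xi> \<xi>' x n \<omega>
       + (if osc_walk \<xi> \<xi>' x n \<omega> \<le> -1 then \<xi> (Suc n) \<omega> else \<xi>' (Suc n) \<omega>)"

text \<open>Crossing times of a single trajectory; the infimum of the empty set is \<open>\<infinity>\<close>.\<close>

primrec crossing_time :: "(nat \<Rightarrow> int) \<Rightarrow> nat \<Rightarrow> enat" where
  "crossing_time x 0 = 0"
| "crossing_time x (Suc k) =
     (case crossing_time x k of
        \<infinity> \<Rightarrow> \<infinity>
      | enat m \<Rightarrow>
          if x m \<le> -1 then Inf {enat n | n. n > m \<and> x n \<ge> 0}
          else Inf {enat n | n. n > m \<and> x n < 0})"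

text \<open>
  The value on the event that some crossing time is infinite is irrelevant: it is a null
  event for increments supported in the positive, respectively negative, integers.
\<close>

definition crossing_walk ::
  "(nat \<Rightarrow> 'w \<Rightarrow> int) \<Rightarrow> (nat \<Rightarrow> 'w \<Rightarrow> int) \<Rightarrow> int \<Rightarrow> nat \<Rightarrow> 'w \<Rightarrow> int"
where
  "crossing_walk \<xi> \<xi>' x k \<omega> =
     osc_walk \<xi> \<xi>' x (the_enat (crossing_time (\<lambda>n. osc_walk \<xi> \<xi>' x n \<omega>) k)) \<omega>"

subsection \<open>Recurrence\<close>

text \<open>
  A Markov chain is given here by a family \<open>Z\<close> of processes on a probability space \<open>M\<close>,
  \<open>Z x\<close> being the chain started at \<open>x\<close>.
\<close>

definition return_time :: "(nat \<Rightarrow> 's) \<Rightarrow> 's \<Rightarrow> enat" where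
  "return_time z y = Inf {enat n | n. n \<ge> 1 \<and> z n = y}"

definition recurrent_state :: "'w measure \<Rightarrow> ('s \<Rightarrow> nat \<Rightarrow> 'w \<Rightarrow> 's) \<Rightarrow> 's \<Rightarrow> bool" where
  "recurrent_state M Z y \<longleftrightarrow> (AE \<omega> in M. return_time (\<lambda>n. Z y n \<omega>) y < \<infinity>)"

definition positive_recurrent_state ::
  "'w measure \<Rightarrow> ('s \<Rightarrow> nat \<Rightarrow> 'w \<Rightarrow> 's) \<Rightarrow> 's \<Rightarrow> bool"
where
  "positive_recurrent_state M Z y \<longleftrightarrow>
     (\<integral>\<^sup>+ \<omega>. ennreal_of_enat (return_time (\<lambda>n. Z y n \<omega>) y) \<partial>M) < \<infinity>"

subsection \<open>The essential classes\<close>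

text \<open>
  \<open>ess_class \<mu> \<mu>'\<close> is the interval \<open>{y. D' \<le> y \<le> D - 1}\<close> with \<open>D\<close> the largest point of the
  support of \<open>\<mu>\<close> and \<open>D'\<close> the smallest point of the support of \<open>\<mu>'\<close>, possibly infinite. When both
  supports have gcd 1, it is the unique closed irreducible class of the walk.
\<close>

definition supp_max :: "int pmf \<Rightarrow> ereal" where
  "supp_max m = (SUP s \<in> set_pmf m. ereal (real_of_int s))"

definition supp_min :: "int pmf \<Rightarrow> ereal" where
  "supp_min m = (INF s \<in> set_pmf m. ereal (real_of_int s))"

definition ess_class :: "int pmf \<Rightarrow> int pmf \<Rightarrow> int set" where
  "ess_class \<mu> \<mu>' =
     {y. supp_min \<mu>' \<le> ereal (real_of_int y) \<and> ereal (real_of_int y) \<le> supp_max \<mu> - 1}"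

definition ess_class_pos :: "int pmf \<Rightarrow> int pmf \<Rightarrow> int set" where
  "ess_class_pos \<mu> \<mu>' = {y \<in> ess_class \<mu> \<mu>'. y \<ge> 0}"

definition ess_class_neg :: "int pmf \<Rightarrow> int pmf \<Rightarrow> int set" where
  "ess_class_neg \<mu> \<mu>' = {y \<in> ess_class \<mu> \<mu>'. y \<le> -1}"

definition crossing_class :: "int pmf \<Rightarrow> int pmf \<Rightarrow> int set" where
  "crossing_class \<mu> \<mu>' =
     {y \<in> ess_class_pos \<mu> \<mu>'. (\<lambda>s. y - s) ` set_pmf \<mu> \<inter> ess_class_neg \<mu> \<mu>' \<noteq> {}}
   \<union> {y \<in> ess_class_neg \<mu> \<mu>'. (\<lambda>s. y - s) ` set_pmf \<mu>' \<inter> ess_class_pos \<mu> \<mu>' \<noteq> {}}"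

subsection \<open>Tails and the measure \<open>\<rho>\<close>\<close>

definition upper_tail :: "int pmf \<Rightarrow> nat \<Rightarrow> real" where
  "upper_tail \<mu> n = measure_pmf.prob \<mu> {int n <..}"

definition lower_tail :: "int pmf \<Rightarrow> nat \<Rightarrow> real" where
  "lower_tail \<mu>' n = measure_pmf.prob \<mu>' {..< - int n}"

text \<open>The sums over \<open>k \<ge> 1\<close> are indexed by \<open>k = i + 1\<close> with \<open>i \<ge> 0\<close>.\<close>

definition rho_mass :: "int pmf \<Rightarrow> int pmf \<Rightarrow> int \<Rightarrow> ennreal" where
  "rho_mass \<mu> \<mu>' n =
     (if n \<le> -1
      then \<Sum>i. let k = int (Suc i) in ennreal (pmf \<mu> k * (\<Sum>j = n - k + 1..n. pmf \<mu>' j))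
      else \<Sum>i. let k = int (Suc i) in ennreal (pmf \<mu>' (- k) * (\<Sum>j = n + 1..n + k. pmf \<mu> j)))"

definition rho :: "int pmf \<Rightarrow> int pmf \<Rightarrow> int measure" where
  "rho \<mu> \<mu>' = density (count_space UNIV) (rho_mass \<mu> \<mu>')"

end

theory Submission
  imports Defs
begin

text \<open>
  The walk has the invariant measure \<open>\<lambda>\<close> with \<open>\<lambda>(x) = \<mu> ]x, \<infinity>[\<close> for \<open>x \<ge> 0\<close> and
  \<open>\<lambda>(x) = \<mu>' ]-\<infinity>, x]\<close> for \<open>x < 0\<close>, and \<open>\<rho>(y)\<close> is the \<open>\<lambda>\<close>-flow into \<open>y\<close> along the
  transitions that cross the origin. Summing over the sources of the transitions instead of their
  targets, the total mass of \<open>\<rho>\<close> is \<open>2 \<Sum> H(n) H'(-n)\<close>.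

  Recurrence follows from a form of Kac's lemma. Kill the walk started at \<open>y\<close> at its first
  transition into \<open>y\<close> from a point of a set \<open>B\<close>, and let \<open>w\<close> be the \<open>\<lambda>\<close>-flow along these
  transitions. Invariance of \<open>\<lambda>\<close> gives \<open>w G \<le> \<lambda>\<close> for the occupation measure \<open>G\<close> of the killed
  walk, so that \<open>w\<close> times the expected number of crossings up to the killing is at most the total
  mass of \<open>\<rho>\<close>. If \<open>B\<close> is the half-line opposite to \<open>y\<close>, then \<open>w = \<rho>(y)\<close> and this number of
  crossings is the return time of the crossing sub-process. If \<open>B = \<int>\<close>, then \<open>w = \<lambda>(y)\<close>, and the
  walk has to return to \<open>y\<close> because every trajectory crosses infinitely often.
\<close>

subsection \<open>Sums over the integers\<close>

lemma nn_integral_count_space_int: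
  fixes f :: "int \<Rightarrow> ennreal"
  shows "(\<integral>\<^sup>+x. f x \<partial>count_space UNIV) = (\<Sum>n. f (int n)) + (\<Sum>n. f (- int n - 1))"
proof -
  have U: "(UNIV :: int set) = {0..} \<union> {..<0}" by auto
  have b1: "bij_betw int UNIV {0..}"
    by (rule bij_betwI[where g = nat]) auto
  have b2: "bij_betw (\<lambda>n. - int n - 1) UNIV {..<0}"
    by (rule bij_betwI[where g = "\<lambda>x. nat (- x - 1)"]) auto
  have "(\<integral>\<^sup>+x. f x \<partial>count_space UNIV)
      = (\<integral>\<^sup>+x. f x * indicator {0..} x + f x * indicator {..<0} x \<partial>count_space UNIV)"
    by (intro nn_integral_cong) (auto simp: indicator_def)
  also have "\<dots> = (\<integral>\<^sup>+x. f x * indicator {0..} x \<partial>count_space UNIV)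
      + (\<integral>\<^sup>+x. f x * indicator {..<0} x \<partial>count_space UNIV)"
    by (rule nn_integral_add) auto
  also have "\<dots> = (\<integral>\<^sup>+x. f x \<partial>count_space {0..}) + (\<integral>\<^sup>+x. f x \<partial>count_space {..<0})"
    by (simp add: nn_integral_count_space_indicator)
  also have "\<dots> = (\<Sum>n. f (int n)) + (\<Sum>n. f (- int n - 1))"
    by (simp flip: nn_integral_count_space_nat
          nn_integral_bij_count_space[OF b1] nn_integral_bij_count_space[OF b2])
  finally show ?thesis .
qed

lemma nn_integral_count_space_swap:
  fixes f :: "'a :: countable \<Rightarrow> 'b :: countable \<Rightarrow> ennreal"
  shows "(\<integral>\<^sup>+x. \<integral>\<^sup>+y. f x y \<partial>count_space UNIV \<partial>count_space UNIV)
    = (\<integral>\<^sup>+y. \<integral>\<^sup>+x. f x y \<partial>count_space UNIV \<partial>count_space UNIV)"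
  using nn_integral_fst_count_space[of "\<lambda>(x, y). f x y"]
    nn_integral_snd_count_space[of "\<lambda>(x, y). f x y"]
  by simp

lemma nn_integral_count_space_reflect:
  fixes f :: "int \<Rightarrow> ennreal"
  shows "(\<integral>\<^sup>+x. f (z - x) \<partial>count_space UNIV) = (\<integral>\<^sup>+x. f x \<partial>count_space UNIV)"
proof -
  have "bij_betw (\<lambda>x. z - x) UNIV UNIV"
    by (rule bij_betwI[where g = "\<lambda>x. z - x"]) auto
  from nn_integral_bij_count_space[OF this] show ?thesis .
qed

lemma nn_integral_pmf_swap:
  fixes p :: "'a :: countable pmf" and q :: "'b :: countable pmf" and f :: "'a \<Rightarrow> 'b \<Rightarrow> ennreal"
  shows "(\<integral>\<^sup>+x. \<integral>\<^sup>+y. f x y \<partial>measure_pmf q \<partial>measure_pmf p) = (\<integral>\<^sup>+y. \<integral>\<^sup>+x. f x y \<partial>measure_pmf p \<partial>measure_pmf q)"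
proof -
  have "(\<integral>\<^sup>+x. \<integral>\<^sup>+y. f x y \<partial>measure_pmf q \<partial>measure_pmf p) =
    (\<integral>\<^sup>+x. \<integral>\<^sup>+y. ennreal (pmf p x) * (ennreal (pmf q y) * f x y) \<partial>count_space UNIV \<partial>count_space UNIV)"
    by (simp add: nn_integral_measure_pmf nn_integral_cmult)
  also have "\<dots> = (\<integral>\<^sup>+y. \<integral>\<^sup>+x. ennreal (pmf q y) * (ennreal (pmf p x) * f x y) \<partial>count_space UNIV \<partial>count_space UNIV)"
    by (subst nn_integral_count_space_swap) (simp add: mult.left_commute)
  also have "\<dots> = (\<integral>\<^sup>+y. \<integral>\<^sup>+x. f x y \<partial>measure_pmf p \<partial>measure_pmf q)"
    by (simp add: nn_integral_measure_pmf nn_integral_cmult)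
  finally show ?thesis .
qed

subsection \<open>The invariant measure and the crossing flow\<close>

definition osc_step :: "int pmf \<Rightarrow> int pmf \<Rightarrow> int \<Rightarrow> int pmf" where
  "osc_step \<mu> \<mu>' x = map_pmf ((+) x) (if x \<le> -1 then \<mu> else \<mu>')"

lemma pmf_osc_step: "pmf (osc_step \<mu> \<mu>' x) z = (if x \<le> -1 then pmf \<mu> (z - x) else pmf \<mu>' (z - x))"
  using pmf_map_inj'[of "(+) x" _ "z - x"] by (simp add: osc_step_def)

definition osc_measure :: "int pmf \<Rightarrow> int pmf \<Rightarrow> int \<Rightarrow> ennreal" where
  "osc_measure \<mu> \<mu>' x = (if x \<le> -1 then emeasure \<mu>' {..x} else emeasure \<mu> {x<..})"

definition opposite :: "int \<Rightarrow> int set" where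
  "opposite x = {z. (z \<le> -1) \<noteq> (x \<le> -1)}"

lemma opposite_commute: "x \<in> opposite z \<longleftrightarrow> z \<in> opposite x"
  by (auto simp: opposite_def)

text \<open>A source below 0 reaches \<open>z\<close> by an increment \<open>k\<close> of law
  \<open>\<mu>\<close>, a source at or above 0 by an increment \<open>j\<close> of law
  \<open>\<mu>'\<close>, and the weight of the source is a tail of the other law. Substituting
  \<open>x = z - k\<close> and \<open>x = z - j\<close> turns both halves of the flow into integrals
  over one independent pair \<open>(k, j)\<close>, so that flow identities reduce to pointwise
  identities between indicators.\<close>

lemma osc_flow_into:
  fixes A :: "int set"
  shows "(\<integral>\<^sup>+x. indicator A x * osc_measure \<mu> \<mu>' x * pmf (osc_step \<mu> \<mu>' x) z \<partial>count_space UNIV)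
    = (\<integral>\<^sup>+k. \<integral>\<^sup>+j. indicator A (z - k) * indicator {..-1} (z - k) * indicator {..z - k} j
         + indicator A (z - j) * indicator {0..} (z - j) * indicator {z - j<..} k \<partial>measure_pmf \<mu>' \<partial>measure_pmf \<mu>)"
    (is "?L = ?R")
proof -
  let ?f = "\<lambda>x. ennreal (pmf \<mu> (z - x)) * (\<integral>\<^sup>+j. indicator A x * indicator {..-1} x * indicator {..x} j \<partial>measure_pmf \<mu>')"
  let ?g = "\<lambda>x. ennreal (pmf \<mu>' (z - x)) * (\<integral>\<^sup>+k. indicator A x * indicator {0..} x * indicator {x<..} k \<partial>measure_pmf \<mu>)"
  have "?L = (\<integral>\<^sup>+x. ?f x + ?g x \<partial>count_space UNIV)"
    by (intro nn_integral_cong)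
      (auto simp: osc_measure_def pmf_osc_step nn_integral_cmult indicator_def[of "{..-1}"] indicator_def[of "{0..}"] mult_ac)
  also have "\<dots> = (\<integral>\<^sup>+x. ?f x \<partial>count_space UNIV) + (\<integral>\<^sup>+x. ?g x \<partial>count_space UNIV)"
    by (rule nn_integral_add) auto
  also have "(\<integral>\<^sup>+x. ?f x \<partial>count_space UNIV)
    = (\<integral>\<^sup>+k. \<integral>\<^sup>+j. indicator A (z - k) * indicator {..-1} (z - k) * indicator {..z - k} j \<partial>measure_pmf \<mu>' \<partial>measure_pmf \<mu>)"
    by (subst nn_integral_count_space_reflect[of _ z, symmetric]) (simp add: nn_integral_measure_pmf)
  also have "(\<integral>\<^sup>+x. ?g x \<partial>count_space UNIV)
    = (\<integral>\<^sup>+j. \<integral>\<^sup>+k. indicator A (z - j) * indicator {0..} (z - j) * indicator {z - j<..} k \<partial>measure_pmf \<mu> \<partial>measure_pmf \<mu>')"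
    by (subst nn_integral_count_space_reflect[of _ z, symmetric]) (simp add: nn_integral_measure_pmf)
  also have "\<dots> = (\<integral>\<^sup>+k. \<integral>\<^sup>+j. indicator A (z - j) * indicator {0..} (z - j) * indicator {z - j<..} k \<partial>measure_pmf \<mu>' \<partial>measure_pmf \<mu>)"
    by (rule nn_integral_pmf_swap)
  finally show ?thesis by (simp add: nn_integral_add)
qed

text \<open>With \<open>k > 0 > j\<close> the two indicators describe disjoint events. For
  \<open>z \<le> -1\<close> these are \<open>j \<le> z - k\<close> and
  \<open>z - k < j \<le> z\<close>, with union \<open>j \<le> z\<close>; for
  \<open>z \<ge> 0\<close> they are \<open>z < k \<le> z - j\<close> and \<open>k > z - j\<close>,
  with union \<open>k > z\<close>.\<close>

lemma osc_measure_invariant: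
  assumes "set_pmf \<mu> \<subseteq> {0<..}" "set_pmf \<mu>' \<subseteq> {..<0}"
  shows "(\<integral>\<^sup>+x. osc_measure \<mu> \<mu>' x * pmf (osc_step \<mu> \<mu>' x) z \<partial>count_space UNIV) = osc_measure \<mu> \<mu>' z"
proof -
  have "(\<integral>\<^sup>+x. osc_measure \<mu> \<mu>' x * pmf (osc_step \<mu> \<mu>' x) z \<partial>count_space UNIV)
    = (\<integral>\<^sup>+k. \<integral>\<^sup>+j. indicator {..-1} (z - k) * indicator {..z - k} j
         + indicator {0..} (z - j) * indicator {z - j<..} k \<partial>measure_pmf \<mu>' \<partial>measure_pmf \<mu>)"
    using osc_flow_into[of UNIV \<mu> \<mu>' z] by simp
  also have "\<dots> = (\<integral>\<^sup>+k. \<integral>\<^sup>+j. (if z \<le> -1 then indicator {..z} j else indicator {z<..} k)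
      \<partial>measure_pmf \<mu>' \<partial>measure_pmf \<mu>)"
    using assms
    by (intro nn_integral_cong_AE AE_pmfI) (auto simp: indicator_def subset_eq; force)
  also have "\<dots> = osc_measure \<mu> \<mu>' z"
    by (simp add: osc_measure_def measure_pmf.emeasure_space_1)
  finally show ?thesis .
qed

text \<open>The inequality behind Kac's lemma. \<open>F m\<close> is the law at time
  \<open>m\<close> of the chain started at \<open>y\<close> and killed at its first transition from
  \<open>B\<close> into \<open>y\<close>. Invariance says that \<open>\<pi>\<close> is its own image
  under the killed kernel plus a point mass at \<open>y\<close>; iterating this identity produces
  the partial sums of the occupation measure, and what remains is nonnegative.\<close>

lemma killed_occupation_le:
  fixes K :: "'a :: countable \<Rightarrow> 'a pmf" and \<pi> :: "'a \<Rightarrow> ennreal" and F :: "nat \<Rightarrow> 'a \<Rightarrow> ennreal"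
  assumes inv: "\<And>z. (\<integral>\<^sup>+x. \<pi> x * pmf (K x) z \<partial>count_space UNIV) = \<pi> z"
    and F0: "\<And>x. F 0 x = indicator {y} x"
    and FSuc: "\<And>m z. F (Suc m) z
      = (\<integral>\<^sup>+x. F m x * pmf (K x) z * (if z = y \<and> x \<in> B then 0 else 1) \<partial>count_space UNIV)"
  shows "(\<integral>\<^sup>+x. indicator B x * \<pi> x * pmf (K x) y \<partial>count_space UNIV) * (\<Sum>m. F m z) \<le> \<pi> z"
proof -
  define w where "w = (\<integral>\<^sup>+x. indicator B x * \<pi> x * pmf (K x) y \<partial>count_space UNIV)"
  define k where "k x z = ennreal (pmf (K x) z) * (if z = y \<and> x \<in> B then 0 else 1)" for x z
  \<comment> \<open>The balance equation with the killed transitions set apart: all of them end at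
    \<open>y\<close>, and their total flow is \<open>w\<close>.\<close>
  have split: "\<pi> z = (\<integral>\<^sup>+x. \<pi> x * k x z \<partial>count_space UNIV) + w * indicator {y} z" for z
  proof -
    have "\<pi> z = (\<integral>\<^sup>+x. \<pi> x * k x z + indicator {y} z * (indicator B x * \<pi> x * pmf (K x) y) \<partial>count_space UNIV)"
      by (subst inv[symmetric], rule nn_integral_cong) (auto simp: k_def indicator_def)
    also have "\<dots> = (\<integral>\<^sup>+x. \<pi> x * k x z \<partial>count_space UNIV)
        + (\<integral>\<^sup>+x. indicator {y} z * (indicator B x * \<pi> x * pmf (K x) y) \<partial>count_space UNIV)"
      by (rule nn_integral_add) auto
    also have "\<dots> = (\<integral>\<^sup>+x. \<pi> x * k x z \<partial>count_space UNIV) + w * indicator {y} z"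
      unfolding w_def by (subst nn_integral_cmult) (auto simp: mult.commute)
    finally show ?thesis .
  qed
  have "w * (\<Sum>m<n. F m z) \<le> \<pi> z" for n z
  proof (induction n arbitrary: z)
    case (Suc n)
    \<comment> \<open>The term \<open>m = 0\<close> is the point mass that matches the second
      summand of \<open>split\<close>; the other terms are one killed step applied to the sum
      bounded by the induction hypothesis.\<close>
    have "w * (\<Sum>m<Suc n. F m z) = w * indicator {y} z + (\<Sum>m<n. w * F (Suc m) z)"
      by (simp add: sum.lessThan_Suc_shift F0 distrib_left sum_distrib_left del: sum.lessThan_Suc)
    also have "(\<Sum>m<n. w * F (Suc m) z) = (\<Sum>m<n. \<integral>\<^sup>+x. w * (F m x * k x z) \<partial>count_space UNIV)"
      by (simp add: FSuc k_def nn_integral_cmult mult.assoc)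
    also have "\<dots> = (\<integral>\<^sup>+x. (w * (\<Sum>m<n. F m x)) * k x z \<partial>count_space UNIV)"
      by (subst nn_integral_sum[symmetric]) (auto simp: sum_distrib_left sum_distrib_right mult_ac)
    also have "\<dots> \<le> (\<integral>\<^sup>+x. \<pi> x * k x z \<partial>count_space UNIV)"
      by (intro nn_integral_mono mult_right_mono Suc.IH) auto
    finally show ?case by (subst split) (simp add: add.commute)
  qed simp
  then have "(SUP n. w * (\<Sum>m<n. F m z)) \<le> \<pi> z" by (intro SUP_least)
  then show ?thesis
    by (simp add: w_def suminf_eq_SUP SUP_mult_left_ennreal)
qed


section \<open>The measure \<open>rho\<close> as a flow across the origin\<close>

lemma nn_integral_pmf_pos_int:
  assumes "set_pmf p \<subseteq> {0<..}"
  shows "(\<integral>\<^sup>+k. f k \<partial>measure_pmf p) = (\<Sum>i. ennreal (pmf p (int (Suc i))) * f (int (Suc i)))"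
proof -
  have z: "pmf p k = 0" if "k \<le> 0" for k
    using that assms by (force simp: pmf_eq_0_set_pmf)
  have b: "bij_betw (\<lambda>i. int (Suc i)) UNIV {0<..}"
    by (rule bij_betwI[where g = "\<lambda>k. nat (k - 1)"]) auto
  have "(\<integral>\<^sup>+k. f k \<partial>measure_pmf p) = (\<integral>\<^sup>+k. ennreal (pmf p k) * f k \<partial>count_space {0<..})"
    by (subst nn_integral_measure_pmf, rule nn_integral_count_space_eq) (auto simp: z)
  also have "\<dots> = (\<Sum>i. ennreal (pmf p (int (Suc i))) * f (int (Suc i)))"
    by (simp flip: nn_integral_count_space_nat nn_integral_bij_count_space[OF b])
  finally show ?thesis .
qed

lemma nn_integral_pmf_neg_int:
  assumes "set_pmf p \<subseteq> {..<0}"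
  shows "(\<integral>\<^sup>+k. f k \<partial>measure_pmf p) = (\<Sum>i. ennreal (pmf p (- int (Suc i))) * f (- int (Suc i)))"
proof -
  have "(\<integral>\<^sup>+k. f k \<partial>measure_pmf p) = (\<integral>\<^sup>+k. f (- k) \<partial>measure_pmf (map_pmf uminus p))"
    by simp
  also have "\<dots> = (\<Sum>i. ennreal (pmf (map_pmf uminus p) (int (Suc i))) * f (- int (Suc i)))"
    by (rule nn_integral_pmf_pos_int) (use assms in auto)
  also have "(\<lambda>k. pmf (map_pmf uminus p) k) = (\<lambda>k. pmf p (- k))"
    using pmf_map_inj'[of uminus p "- k" for k] by auto
  finally show ?thesis .
qed

text \<open>Only sources on the other side of the origin contribute, so one of the two terms of
  \<open>osc_flow_into\<close> vanishes. The surviving one is the indicator of a finite interval: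
  \<open>y - k < j \<le> y\<close> if \<open>y\<close> is negative, \<open>y < k \<le> y - j\<close>
  otherwise. These are the intervals in the definition of \<open>rho_mass\<close>.\<close>

lemma rho_mass_eq_flow:
  assumes "set_pmf \<mu> \<subseteq> {0<..}" "set_pmf \<mu>' \<subseteq> {..<0}"
  shows "rho_mass \<mu> \<mu>' y
    = (\<integral>\<^sup>+x. indicator (opposite y) x * osc_measure \<mu> \<mu>' x * pmf (osc_step \<mu> \<mu>' x) y \<partial>count_space UNIV)"
proof (cases "y \<le> -1")
  case True
  have "(\<integral>\<^sup>+x. indicator (opposite y) x * osc_measure \<mu> \<mu>' x * pmf (osc_step \<mu> \<mu>' x) y \<partial>count_space UNIV)
    = (\<integral>\<^sup>+k. \<integral>\<^sup>+j. indicator {y - k + 1..y} j \<partial>measure_pmf \<mu>' \<partial>measure_pmf \<mu>)"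
    unfolding osc_flow_into using True
    by (intro nn_integral_cong) (auto simp: indicator_def opposite_def)
  also have "\<dots> = (\<integral>\<^sup>+k. ennreal (\<Sum>j = y - k + 1..y. pmf \<mu>' j) \<partial>measure_pmf \<mu>)"
    by (simp add: measure_pmf.emeasure_eq_measure measure_measure_pmf_finite)
  also have "\<dots> = rho_mass \<mu> \<mu>' y"
    using True by (simp add: nn_integral_pmf_pos_int[OF assms(1)] rho_mass_def Let_def ennreal_mult sum_nonneg del: of_nat_Suc)
  finally show ?thesis by simp
next
  case False
  have "(\<integral>\<^sup>+x. indicator (opposite y) x * osc_measure \<mu> \<mu>' x * pmf (osc_step \<mu> \<mu>' x) y \<partial>count_space UNIV)
    = (\<integral>\<^sup>+k. \<integral>\<^sup>+j. indicator {y + 1..y - j} k \<partial>measure_pmf \<mu>' \<partial>measure_pmf \<mu>)"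
    unfolding osc_flow_into using False
    by (intro nn_integral_cong) (auto simp: indicator_def opposite_def)
  also have "\<dots> = (\<integral>\<^sup>+j. ennreal (\<Sum>k = y + 1..y - j. pmf \<mu> k) \<partial>measure_pmf \<mu>')"
    by (subst nn_integral_pmf_swap) (simp add: measure_pmf.emeasure_eq_measure measure_measure_pmf_finite)
  also have "\<dots> = rho_mass \<mu> \<mu>' y"
    using False by (simp add: nn_integral_pmf_neg_int[OF assms(2)] rho_mass_def Let_def ennreal_mult sum_nonneg del: of_nat_Suc)
  finally show ?thesis by simp
qed

section \<open>The essential classes as supports of the invariant measure and of
  \<open>rho\<close>\<close>

text \<open>Removes the extended reals: the bounds may be infinite, but over the integers each
  inequality amounts to the existence of one support point. The \<open>- 1\<close> in the upper
  bound becomes the strictness of \<open>x < k\<close>.\<close>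

lemma ess_class_iff:
  assumes "set_pmf \<mu> \<subseteq> {0<..}" "set_pmf \<mu>' \<subseteq> {..<0}"
  shows "x \<in> ess_class \<mu> \<mu>' \<longleftrightarrow> (\<exists>j\<in>set_pmf \<mu>'. j \<le> x) \<and> (\<exists>k\<in>set_pmf \<mu>. x < k)"
proof -
  have "supp_min \<mu>' \<le> ereal (real_of_int x) \<longleftrightarrow> (\<exists>j\<in>set_pmf \<mu>'. j \<le> x)"
  proof
    assume le: "supp_min \<mu>' \<le> ereal (real_of_int x)"
    show "\<exists>j\<in>set_pmf \<mu>'. j \<le> x"
    proof (rule ccontr)
      assume "\<not> ?thesis"
      then have "ereal (real_of_int (x + 1)) \<le> supp_min \<mu>'"
        unfolding supp_min_def by (intro INF_greatest) auto
      with le have "ereal (real_of_int (x + 1)) \<le> ereal (real_of_int x)" by (rule order_trans[rotated])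
      then show False by simp
    qed
  qed (auto simp: supp_min_def intro: INF_lower2)
  moreover have "ereal (real_of_int x) \<le> supp_max \<mu> - 1 \<longleftrightarrow> (\<exists>k\<in>set_pmf \<mu>. x < k)"
  proof
    assume le: "ereal (real_of_int x) \<le> supp_max \<mu> - 1"
    show "\<exists>k\<in>set_pmf \<mu>. x < k"
    proof (rule ccontr)
      assume "\<not> ?thesis"
      then have "supp_max \<mu> \<le> ereal (real_of_int x)"
        unfolding supp_max_def by (intro SUP_least) auto
      then have "supp_max \<mu> - 1 \<le> ereal (real_of_int x) - 1" by (rule ereal_minus_mono) simp
      with le have "ereal (real_of_int x) \<le> ereal (real_of_int x) - 1" by (rule order_trans)
      then show False by (simp add: one_ereal_def)
    qed
  next
    assume "\<exists>k\<in>set_pmf \<mu>. x < k"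
    then have "ereal (real_of_int (x + 1)) \<le> supp_max \<mu>"
      unfolding supp_max_def by (auto intro: SUP_upper2)
    then have "ereal (real_of_int (x + 1)) - 1 \<le> supp_max \<mu> - 1" by (rule ereal_minus_mono) simp
    then show "ereal (real_of_int x) \<le> supp_max \<mu> - 1" by (simp add: one_ereal_def)
  qed
  ultimately show ?thesis by (simp add: ess_class_def)
qed

lemma emeasure_pmf_eq_0_iff: "emeasure (measure_pmf p) A = 0 \<longleftrightarrow> set_pmf p \<inter> A = {}"
  by (simp add: measure_pmf.emeasure_eq_measure measure_pmf_zero_iff)

text \<open>On each half-line one of the two conditions of \<open>ess_class_iff\<close> holds by the
  signs of the supports, and the other one says that the tail defining \<open>osc_measure\<close> is
  nonzero.\<close>

lemma osc_measure_eq_0_iff: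
  assumes "set_pmf \<mu> \<subseteq> {0<..}" "set_pmf \<mu>' \<subseteq> {..<0}"
  shows "osc_measure \<mu> \<mu>' x = 0 \<longleftrightarrow> x \<notin> ess_class \<mu> \<mu>'"
proof -
  obtain k j where "k \<in> set_pmf \<mu>" "j \<in> set_pmf \<mu>'"
    using set_pmf_not_empty[of \<mu>] set_pmf_not_empty[of \<mu>'] by blast
  moreover from this assms have "0 < k" "j < 0" by auto
  ultimately have "\<not> x \<le> -1 \<Longrightarrow> \<exists>j\<in>set_pmf \<mu>'. j \<le> x" "x \<le> -1 \<Longrightarrow> \<exists>k\<in>set_pmf \<mu>. x < k"
    by - (rule bexI[of _ j], auto, rule bexI[of _ k], auto)
  moreover have "set_pmf \<mu>' \<inter> {..x} = {} \<longleftrightarrow> \<not> (\<exists>j\<in>set_pmf \<mu>'. j \<le> x)"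
    "set_pmf \<mu> \<inter> {x<..} = {} \<longleftrightarrow> \<not> (\<exists>k\<in>set_pmf \<mu>. x < k)"
    by auto
  ultimately show ?thesis
    unfolding osc_measure_def ess_class_iff[OF assms]
    by (cases "x \<le> -1") (simp_all add: emeasure_pmf_eq_0_iff)
qed

text \<open>The flow into \<open>y\<close> is nonzero exactly when some point of the essential class
  on the other side can jump to \<open>y\<close>. The crossing class also requires \<open>y\<close>
  itself to be essential, which has to be derived from the jump.\<close>

lemma rho_mass_eq_0_iff:
  assumes "set_pmf \<mu> \<subseteq> {0<..}" "set_pmf \<mu>' \<subseteq> {..<0}"
  shows "rho_mass \<mu> \<mu>' y = 0 \<longleftrightarrow> y \<notin> crossing_class \<mu> \<mu>'"
proof -
  have "rho_mass \<mu> \<mu>' y = 0 \<longleftrightarrow>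
      (\<forall>x. x \<in> opposite y \<longrightarrow> x \<in> ess_class \<mu> \<mu>' \<longrightarrow> y \<notin> set_pmf (osc_step \<mu> \<mu>' x))"
    by (auto simp: rho_mass_eq_flow[OF assms] nn_integral_0_iff_AE AE_count_space
        osc_measure_eq_0_iff[OF assms] pmf_eq_0_set_pmf indicator_def)
  also have "\<dots> \<longleftrightarrow> y \<notin> crossing_class \<mu> \<mu>'"
  proof
    assume *: "\<forall>x. x \<in> opposite y \<longrightarrow> x \<in> ess_class \<mu> \<mu>' \<longrightarrow> y \<notin> set_pmf (osc_step \<mu> \<mu>' x)"
    show "y \<notin> crossing_class \<mu> \<mu>'"
    proof
      assume "y \<in> crossing_class \<mu> \<mu>'"
      then consider s where "0 \<le> y" "s \<in> set_pmf \<mu>" "y - s \<in> ess_class \<mu> \<mu>'" "y - s \<le> -1"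
        | s where "y \<le> -1" "s \<in> set_pmf \<mu>'" "y - s \<in> ess_class \<mu> \<mu>'" "0 \<le> y - s"
        by (auto simp: crossing_class_def ess_class_pos_def ess_class_neg_def)
      then show False
      proof cases
        case 1
        then show False using *[rule_format, of "y - s"] by (auto simp: opposite_def osc_step_def)
      next
        case 2
        then show False using *[rule_format, of "y - s"] by (auto simp: opposite_def osc_step_def)
      qed
    qed
  next
    assume *: "y \<notin> crossing_class \<mu> \<mu>'"
    show "\<forall>x. x \<in> opposite y \<longrightarrow> x \<in> ess_class \<mu> \<mu>' \<longrightarrow> y \<notin> set_pmf (osc_step \<mu> \<mu>' x)"
    proof (intro allI impI notI)
      fix x assume x: "x \<in> opposite y" "x \<in> ess_class \<mu> \<mu>'" and y: "y \<in> set_pmf (osc_step \<mu> \<mu>' x)"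
      obtain j k where "j \<in> set_pmf \<mu>'" "k \<in> set_pmf \<mu>"
        using set_pmf_not_empty[of \<mu>] set_pmf_not_empty[of \<mu>'] by blast
      then have jk: "j \<in> set_pmf \<mu>'" "j < 0" "k \<in> set_pmf \<mu>" "0 < k"
        using assms by auto
      show False
      proof (cases "x \<le> -1")
        case True
        then obtain s where s: "s \<in> set_pmf \<mu>" "y = x + s" using y by (auto simp: osc_step_def)
        have "0 \<le> y" using True x by (auto simp: opposite_def)
        \<comment> \<open>The jump \<open>s\<close> from \<open>x \<le> -1\<close> gives
          \<open>y = x + s < s\<close>, so \<open>s\<close> is the upper witness; any support point
          \<open>j < 0 \<le> y\<close> is the lower one.\<close>
        moreover have "y \<in> ess_class \<mu> \<mu>'"
          unfolding ess_class_iff[OF assms] using s jk True \<open>0 \<le> y\<close>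
          by (intro conjI bexI[of _ j] bexI[of _ s]) auto
        ultimately show False
          using * x(2) s True
          by (auto simp: crossing_class_def ess_class_pos_def ess_class_neg_def)
      next
        case False
        then obtain s where s: "s \<in> set_pmf \<mu>'" "y = x + s" using y by (auto simp: osc_step_def)
        have "y \<le> -1" using False x by (auto simp: opposite_def)
        \<comment> \<open>Here \<open>x \<ge> 0\<close> gives \<open>s \<le> x + s = y\<close>, so
          \<open>s\<close> is the lower witness; any support point \<open>k > 0 > y\<close> is the
          upper one.\<close>
        moreover have "y \<in> ess_class \<mu> \<mu>'"
          unfolding ess_class_iff[OF assms] using s jk False \<open>y \<le> -1\<close>
          by (intro conjI bexI[of _ s] bexI[of _ k]) auto
        ultimately show False
          using * x(2) s False
          by (auto simp: crossing_class_def ess_class_pos_def ess_class_neg_def)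
      qed
    qed
  qed
  finally show ?thesis .
qed

section \<open>The total crossing flow and the tail series\<close>

definition crossing_flow :: "int pmf \<Rightarrow> int pmf \<Rightarrow> ennreal" where
  "crossing_flow \<mu> \<mu>' = (\<integral>\<^sup>+x. osc_measure \<mu> \<mu>' x * emeasure (osc_step \<mu> \<mu>' x) (opposite x) \<partial>count_space UNIV)"

text \<open>\<open>rho\<close> vanishes off the crossing class, so its mass there is its full mass.
  Tonelli then sums the flow by sources instead of targets, using the symmetry of
  \<open>opposite\<close>.\<close>

lemma emeasure_rho_crossing_class:
  assumes "set_pmf \<mu> \<subseteq> {0<..}" "set_pmf \<mu>' \<subseteq> {..<0}"
  shows "emeasure (rho \<mu> \<mu>') (crossing_class \<mu> \<mu>') = crossing_flow \<mu> \<mu>'"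
proof -
  have "emeasure (rho \<mu> \<mu>') (crossing_class \<mu> \<mu>') = (\<integral>\<^sup>+y. rho_mass \<mu> \<mu>' y \<partial>count_space UNIV)"
    unfolding rho_def
    by (subst emeasure_density) (auto intro!: nn_integral_cong simp: indicator_def rho_mass_eq_0_iff[OF assms])
  also have "\<dots> = (\<integral>\<^sup>+x. \<integral>\<^sup>+y. osc_measure \<mu> \<mu>' x * (ennreal (pmf (osc_step \<mu> \<mu>' x) y) * indicator (opposite x) y)
      \<partial>count_space UNIV \<partial>count_space UNIV)"
    unfolding rho_mass_eq_flow[OF assms]
    by (subst nn_integral_count_space_swap)
      (auto intro!: nn_integral_cong simp: indicator_def opposite_commute)
  also have "\<dots> = crossing_flow \<mu> \<mu>'"
    unfolding crossing_flow_def
    by (intro nn_integral_cong, subst nn_integral_cmult)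
      (simp_all flip: nn_integral_measure_pmf)
  finally show ?thesis .
qed

text \<open>The sources \<open>n\<close> and \<open>-n - 1\<close> contribute equally. From
  \<open>n\<close> a jump below \<open>-n\<close> is needed to cross, from \<open>-n - 1\<close> a
  jump above \<open>n\<close>, and in both cases the weight of the source is the other of the two
  tails.\<close>

lemma crossing_flow_eq:
  "crossing_flow \<mu> \<mu>' = 2 * (\<Sum>n. ennreal (upper_tail \<mu> n * lower_tail \<mu>' n))"
proof -
  have pos: "osc_measure \<mu> \<mu>' (int n) * emeasure (osc_step \<mu> \<mu>' (int n)) (opposite (int n))
      = ennreal (upper_tail \<mu> n * lower_tail \<mu>' n)" for n
  proof -
    have "(+) (int n) -` opposite (int n) = {..<- int n}" by (auto simp: opposite_def)
    then show ?thesis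
      by (simp add: osc_measure_def osc_step_def upper_tail_def lower_tail_def
          measure_pmf.emeasure_eq_measure ennreal_mult)
  qed
  have neg: "osc_measure \<mu> \<mu>' (- int n - 1) * emeasure (osc_step \<mu> \<mu>' (- int n - 1)) (opposite (- int n - 1))
      = ennreal (upper_tail \<mu> n * lower_tail \<mu>' n)" for n
  proof -
    have "(+) (- int n - 1) -` opposite (- int n - 1) = {int n<..}" "{..- int n - 1} = {..<- int n}"
      by (auto simp: opposite_def)
    then show ?thesis
      by (simp add: osc_measure_def osc_step_def upper_tail_def lower_tail_def
          measure_pmf.emeasure_eq_measure ennreal_mult mult.commute)
  qed
  show ?thesis
    unfolding crossing_flow_def nn_integral_count_space_int pos neg by (simp add: mult_2)
qed

lemma crossing_flow_finite_iff:
  "crossing_flow \<mu> \<mu>' < \<infinity> \<longleftrightarrow> summable (\<lambda>n. upper_tail \<mu> n * lower_tail \<mu>' n)"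
proof -
  have nonneg: "0 \<le> upper_tail \<mu> n * lower_tail \<mu>' n" for n
    by (simp add: upper_tail_def lower_tail_def)
  have "crossing_flow \<mu> \<mu>' < \<infinity> \<longleftrightarrow> (\<Sum>n. ennreal (upper_tail \<mu> n * lower_tail \<mu>' n)) \<noteq> top"
    by (auto simp: crossing_flow_eq ennreal_mult_less_top less_top)
  also have "\<dots> \<longleftrightarrow> summable (\<lambda>n. upper_tail \<mu> n * lower_tail \<mu>' n)"
    using summable_suminf_not_top[OF nonneg] suminf_ennreal2[OF nonneg] by auto
  finally show ?thesis .
qed


subsection \<open>Crossings of a single trajectory\<close>

lemma of_nat_le_suminf_indicator:
  assumes "finite T" "T \<subseteq> S"
  shows "of_nat (card T) \<le> (\<Sum>n. indicator S n :: ennreal)"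
proof -
  have "of_nat (card T) = (\<Sum>n\<in>T. indicator S n :: ennreal)"
    using assms(2) by (subst sum.cong[OF refl, of _ _ "\<lambda>_. 1"]) (auto simp: indicator_def)
  also have "\<dots> \<le> (\<Sum>n. indicator S n :: ennreal)"
    by (rule sum_le_suminf) (use assms in auto)
  finally show ?thesis .
qed

lemma ennreal_eq_top_if_ge_of_nat: "x = top" if "\<And>n. of_nat n \<le> (x :: ennreal)"
  using that ennreal_Ex_less_of_nat[of x] by (metis less_top not_less)

lemma suminf_indicator_infinite: "infinite S \<Longrightarrow> (\<Sum>n. indicator S n :: ennreal) = top"
  by (rule ennreal_eq_top_if_ge_of_nat)
    (metis infinite_arbitrarily_large of_nat_le_suminf_indicator)

text \<open>The index is the time just before the jump, so the corresponding crossing time is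
  \<open>Suc n\<close>.\<close>

definition crosses :: "(nat \<Rightarrow> int) \<Rightarrow> nat \<Rightarrow> bool" where
  "crosses x n \<longleftrightarrow> x (Suc n) \<in> opposite (x n)"

text \<open>The deterministic content of the sign conditions on the supports; the pathwise arguments
  use the increments only through it.\<close>

definition attracted :: "(nat \<Rightarrow> int) \<Rightarrow> bool" where
  "attracted x \<longleftrightarrow> (\<forall>n. if x n \<le> -1 then x n < x (Suc n) else x (Suc n) < x n)"

lemma same_side_if_not_crosses:
  assumes "\<And>i. m \<le> i \<Longrightarrow> i < n \<Longrightarrow> \<not> crosses x i" "m \<le> n"
  shows "x n \<le> -1 \<longleftrightarrow> x m \<le> -1"
  using assms(2,1)
proof (induction n rule: dec_induct)
  case (step n)
  then have "\<not> crosses x n" "x n \<le> -1 \<longleftrightarrow> x m \<le> -1" by auto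
  then show ?case by (auto simp: crosses_def opposite_def)
qed simp

text \<open>Without a crossing the path moves towards the origin by at least 1 at every step, hence
  has to pass it.\<close>

lemma attracted_crosses_after:
  assumes "attracted x"
  shows "\<exists>n\<ge>m. crosses x n"
proof (rule ccontr)
  assume *: "\<not> ?thesis"
  then have side: "x (m + i) \<le> -1 \<longleftrightarrow> x m \<le> -1" for i
    by (intro same_side_if_not_crosses) auto
  show False
  proof (cases "x m \<le> -1")
    case True
    have "x m + int i \<le> x (m + i)" for i
    proof (induction i)
      case (Suc i)
      then show ?case using assms side[of i] True by (auto simp: attracted_def dest: spec[of _ "m + i"])
    qed simp
    from this[of "nat (- x m)"] side[of "nat (- x m)"] True show False by simp
  next
    case False
    have "x (m + i) \<le> x m - int i" for i
    proof (induction i)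
      case (Suc i)
      have "x (Suc (m + i)) < x (m + i)" using assms side[of i] False by (auto simp: attracted_def)
      with Suc show ?case by simp
    qed simp
    \<comment> \<open>Since 0 counts as nonnegative, one step more is needed here than on the
      negative side.\<close>
    from this[of "nat (x m + 1)"] side[of "nat (x m + 1)"] False show False by simp
  qed
qed

lemma attracted_infinite_crosses: "attracted x \<Longrightarrow> infinite {n. crosses x n}"
  using attracted_crosses_after by (auto simp: infinite_nat_iff_unbounded_le)

lemma crossing_time_Suc_eq:
  assumes k: "crossing_time x k = enat m" and n: "m \<le> n" "crosses x n"
    and least: "\<And>i. m \<le> i \<Longrightarrow> i < n \<Longrightarrow> \<not> crosses x i"
  shows "crossing_time x (Suc k) = enat (Suc n)"
proof -
  have side: "x i \<le> -1 \<longleftrightarrow> x m \<le> -1" if "m \<le> i" "i \<le> n" for i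
    using that by (intro same_side_if_not_crosses least) auto
  have opp: "x (Suc n) \<le> -1 \<longleftrightarrow> \<not> x m \<le> -1"
    using n side[of n] by (auto simp: crosses_def opposite_def)
  \<comment> \<open>Both infima in the definition of \<open>crossing_time\<close> are instances of
    this one, once \<open>0 \<le> v\<close> and \<open>v < 0\<close> are written in terms of
    \<open>v \<le> -1\<close>.\<close>
  have "Inf {enat j |j. j > m \<and> (x j \<le> -1) \<noteq> (x m \<le> -1)} = enat (Suc n)"
  proof (rule antisym)
    show "Inf {enat j |j. j > m \<and> (x j \<le> -1) \<noteq> (x m \<le> -1)} \<le> enat (Suc n)"
      using opp n by (intro Inf_lower) auto
    show "enat (Suc n) \<le> Inf {enat j |j. j > m \<and> (x j \<le> -1) \<noteq> (x m \<le> -1)}"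
    proof (rule Inf_greatest, clarify)
      fix j assume "m < j" "(x j \<le> -1) \<noteq> (x m \<le> -1)"
      then show "enat (Suc n) \<le> enat j" using side[of j] by (cases "j \<le> n") auto
    qed
  qed
  moreover have "0 \<le> v \<longleftrightarrow> \<not> v \<le> -1" "v < 0 \<longleftrightarrow> v \<le> -1" for v :: int by auto
  ultimately show ?thesis
    unfolding crossing_time.simps k by (cases "x m \<le> -1") (simp_all only: if_True if_False enat.case simp_thms)
qed

text \<open>Replaces the possibly infinite infima by a strictly increasing sequence of naturals. The
  last clause says that each block from \<open>t k\<close> up to \<open>t (Suc k)\<close> contains
  exactly one crossing, made by its final jump.\<close>

lemma crossing_time_enum:
  assumes "attracted x"
  shows "\<exists>t. t 0 = 0 \<and> (\<forall>k. crossing_time x k = enat (t k)) \<and> strict_mono t \<and>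
    (\<forall>k i. t k \<le> i \<longrightarrow> i < t (Suc k) \<longrightarrow> (crosses x i \<longleftrightarrow> Suc i = t (Suc k)))"
proof -
  define next_cr where "next_cr m = (LEAST n. m \<le> n \<and> crosses x n)" for m
  define t where "t k = rec_nat 0 (\<lambda>_ m. Suc (next_cr m)) k" for k
  have t_simps: "t 0 = 0" "t (Suc k) = Suc (next_cr (t k))" for k by (simp_all add: t_def)
  have next_cr: "m \<le> next_cr m" "crosses x (next_cr m)" for m
    using LeastI_ex[of "\<lambda>n. m \<le> n \<and> crosses x n"] attracted_crosses_after[OF assms, of m]
    by (auto simp: next_cr_def)
  have least: "\<not> crosses x i" if "m \<le> i" "i < next_cr m" for m i
    using that not_less_Least[of i "\<lambda>n. m \<le> n \<and> crosses x n"] by (auto simp: next_cr_def)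
  show ?thesis
  proof (intro exI conjI allI impI)
    show "crossing_time x k = enat (t k)" for k
    proof (induction k)
      case (Suc k)
      from crossing_time_Suc_eq[OF this next_cr least] show ?case by (simp add: t_simps del: crossing_time.simps)
    qed (simp add: t_simps zero_enat_def)
    show "strict_mono t"
      using next_cr(1) by (auto simp: strict_mono_Suc_iff t_simps less_Suc_eq_le)
    show "crosses x i \<longleftrightarrow> Suc i = t (Suc k)" if "t k \<le> i" "i < t (Suc k)" for k i
      using that next_cr(2)[of "t k"] least[of "t k" i] by (auto simp: t_simps less_Suc_eq)
  qed (rule t_simps)
qed

section \<open>Counting the crossings of a trajectory up to killing\<close>

text \<open>Not yet killed at time \<open>n\<close>. Only arrivals at times \<open>1\<close> to
  \<open>n\<close> matter, so starting at \<open>y\<close> does not kill.\<close>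

definition survives :: "int \<Rightarrow> int set \<Rightarrow> (nat \<Rightarrow> int) \<Rightarrow> nat \<Rightarrow> bool" where
  "survives y B x n \<longleftrightarrow> (\<forall>i<n. x i \<in> B \<longrightarrow> x (Suc i) \<noteq> y)"

lemma le_return_timeD:
  assumes "enat K \<le> return_time z y" "1 \<le> k" "k < K"
  shows "z k \<noteq> y"
proof
  assume "z k = y"
  then have "return_time z y \<le> enat k"
    unfolding return_time_def using assms(2) by (intro Inf_lower) auto
  with assms show False by (metis enat_ord_simps(1) not_le order_trans)
qed

text \<open>A transition into \<open>y\<close> from the opposite side is a crossing that lands on
  \<open>y\<close>, hence a return of the crossing sub-process. If the return time is at least
  \<open>K\<close>, the first \<open>K\<close> crossings therefore all start before the killing and
  are counted.\<close>

lemma crossing_return_time_le: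
  assumes "attracted x"
  shows "ennreal_of_enat (return_time (\<lambda>k. x (the_enat (crossing_time x k))) y)
    \<le> (\<Sum>n. indicator {n. crosses x n \<and> survives y (opposite y) x n} n)" (is "ennreal_of_enat ?R \<le> ?N")
proof -
  obtain t where t: "t 0 = 0" "\<And>k. crossing_time x k = enat (t k)" "strict_mono t"
    "\<And>k i. t k \<le> i \<Longrightarrow> i < t (Suc k) \<Longrightarrow> crosses x i \<longleftrightarrow> Suc i = t (Suc k)"
    using crossing_time_enum[OF assms] by blast
  have pos: "0 < t (Suc k)" for k
    using strict_monoD[OF t(3), of 0 "Suc k"] by (simp add: t)
  have "of_nat K \<le> ?N" if K: "enat K \<le> ?R" for K
  proof -
    have "inj_on (\<lambda>k. t (Suc k) - 1) {..<K}"
    proof (rule inj_onI)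
      fix a b assume "t (Suc a) - 1 = t (Suc b) - 1"
      then have "t (Suc a) = t (Suc b)" using pos[of a] pos[of b] by linarith
      then show "a = b" by (simp add: strict_mono_eq[OF t(3)])
    qed
    then have card: "card ((\<lambda>k. t (Suc k) - 1) ` {..<K}) = K"
      by (simp add: card_image)
    \<comment> \<open>Survival is required only up to the time before the jump, so a
      \<open>K\<close>-th crossing that itself lands on \<open>y\<close> still counts.\<close>
    have "t (Suc k) - 1 \<in> {n. crosses x n \<and> survives y (opposite y) x n}" if "k < K" for k
    proof (clarsimp simp: survives_def, intro conjI allI impI)
      have "t k \<le> t (Suc k) - 1" "t (Suc k) - 1 < t (Suc k)"
        using strict_monoD[OF t(3), of k "Suc k"] by auto
      from t(4)[OF this] show "crosses x (t (Suc k) - Suc 0)" using pos by simp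
      fix i assume i: "i < t (Suc k) - Suc 0" and opp: "x i \<in> opposite y"
      show "x (Suc i) \<noteq> y"
      proof
        assume y: "x (Suc i) = y"
        then have cr: "crosses x i" using opp by (simp add: crosses_def opposite_commute)
        \<comment> \<open>Locates the block of crossing times containing \<open>i\<close>; as
          \<open>i\<close> is a crossing, it is the last index of its block, so \<open>Suc i\<close>
          is itself a crossing time.\<close>
        define j where "j = (LEAST j. i < t j)"
        have ij: "i < t j" unfolding j_def by (rule LeastI[of _ "Suc k"]) (use i in simp)
        then obtain l where l: "j = Suc l" using t(1) by (cases j) auto
        have "t l \<le> i" using not_less_Least[of l "\<lambda>j. i < t j"] l by (auto simp: j_def)
        from t(4)[OF this] ij l cr have tl: "Suc i = t (Suc l)" by simp
        with i have "t (Suc l) < t (Suc k)" by simp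
        then have "Suc l < K" using strict_mono_less[OF t(3)] that by auto
        from le_return_timeD[OF K _ this] have "x (t (Suc l)) \<noteq> y"
          by (simp add: t(2) del: crossing_time.simps)
        with y tl show False by simp
      qed
    qed
    then have "of_nat (card ((\<lambda>k. t (Suc k) - 1) ` {..<K})) \<le> ?N"
      by (intro of_nat_le_suminf_indicator) auto
    with card show ?thesis by simp
  qed
  note * = this
  show ?thesis
  proof (cases ?R)
    case (enat K)
    then show ?thesis using *[of K] by simp
  next
    case infinity
    then show ?thesis using ennreal_eq_top_if_ge_of_nat[of ?N] * by simp
  qed
qed

text \<open>For \<open>B = UNIV\<close> killing means returning to \<open>y\<close>; a path that
  never returns survives forever, and it crosses infinitely often.\<close>

lemma crossings_infinite_if_no_return:
  assumes "attracted x" "\<not> return_time x y < \<infinity>"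
  shows "(\<Sum>n. indicator {n. crosses x n \<and> survives y UNIV x n} n :: ennreal) = top"
proof -
  have "x k \<noteq> y" if "1 \<le> k" for k
    using le_return_timeD[of "Suc k" x y k] assms(2) that by simp
  then have "survives y UNIV x n" for n by (simp add: survives_def)
  then show ?thesis
    using attracted_infinite_crosses[OF assms(1)] by (simp add: suminf_indicator_infinite)
qed


subsection \<open>The killed walk\<close>

lemma measurable_count_space_apply2:
  assumes "f \<in> measurable N (count_space UNIV)" "g \<in> measurable N (count_space UNIV)"
  shows "(\<lambda>\<omega>. h (f \<omega> :: 'a :: countable) (g \<omega> :: 'b :: countable)) \<in> measurable N (count_space UNIV)"
proof -
  have "(\<lambda>\<omega>. (f \<omega>, g \<omega>)) \<in> measurable N (count_space UNIV \<Otimes>\<^sub>M count_space UNIV)"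
    using assms by (rule measurable_Pair)
  then have "(\<lambda>\<omega>. (f \<omega>, g \<omega>)) \<in> measurable N (count_space UNIV)"
    by (simp add: pair_measure_countable)
  from measurable_compose[OF this, of "\<lambda>(a, b). h a b" "count_space UNIV"] show ?thesis by simp
qed

locale oscillating_walk = prob_space M
  for M :: "'w measure" and \<mu> \<mu>' :: "int pmf" and \<xi> \<xi>' :: "nat \<Rightarrow> 'w \<Rightarrow> int" +
  assumes supp: "set_pmf \<mu> \<subseteq> {0<..}" "set_pmf \<mu>' \<subseteq> {..<0}"
    and indep: "indep_vars (\<lambda>_. count_space UNIV) (\<lambda>n \<omega>. (\<xi> n \<omega>, \<xi>' n \<omega>)) {1..}"
    and law: "\<And>n. n \<ge> 1 \<Longrightarrow> distr M (count_space UNIV) (\<xi> n) = measure_pmf \<mu>"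
    and law': "\<And>n. n \<ge> 1 \<Longrightarrow> distr M (count_space UNIV) (\<xi>' n) = measure_pmf \<mu>'"
begin

abbreviation X :: "int \<Rightarrow> nat \<Rightarrow> 'w \<Rightarrow> int" where "X \<equiv> osc_walk \<xi> \<xi>'"

lemma measurable_increments:
  assumes "n \<ge> 1"
  shows "\<xi> n \<in> measurable M (count_space UNIV)" "\<xi>' n \<in> measurable M (count_space UNIV)"
proof -
  have *: "(\<lambda>\<omega>. (\<xi> n \<omega>, \<xi>' n \<omega>)) \<in> measurable M (count_space UNIV)"
    using indep assms by (auto simp: indep_vars_def)
  from measurable_compose[OF *, of fst "count_space UNIV"] measurable_compose[OF *, of snd "count_space UNIV"]
  show "\<xi> n \<in> measurable M (count_space UNIV)" "\<xi>' n \<in> measurable M (count_space UNIV)" by simp_all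
qed

lemma measurable_osc_walk: "X y n \<in> measurable M (count_space UNIV)"
proof (induction n)
  case (Suc n)
  have "(\<lambda>\<omega>. (\<xi> (Suc n) \<omega>, \<xi>' (Suc n) \<omega>)) \<in> measurable M (count_space UNIV)"
    using indep by (auto simp: indep_vars_def)
  from measurable_count_space_apply2[OF Suc this, of "\<lambda>x p. x + (if x \<le> -1 then fst p else snd p)"]
  have "(\<lambda>\<omega>. X y n \<omega> + (if X y n \<omega> \<le> -1 then \<xi> (Suc n) \<omega> else \<xi>' (Suc n) \<omega>)) \<in> measurable M (count_space UNIV)"
    by (simp only: fst_conv snd_conv)
  moreover have "X y (Suc n) = (\<lambda>\<omega>. X y n \<omega> + (if X y n \<omega> \<le> -1 then \<xi> (Suc n) \<omega> else \<xi>' (Suc n) \<omega>))"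
    by (rule ext) (rule osc_walk.simps)
  ultimately show ?case by (simp only:)
next
  case 0
  have "X y 0 = (\<lambda>_. y)" by (rule ext) (rule osc_walk.simps)
  then show ?case by simp
qed

text \<open>Stated for an arbitrary family because it serves twice: for the walk on \<open>M\<close>
  and for its copy on the product space of increments in \<open>markov_step\<close>.\<close>

lemma sets_survives:
  assumes "\<And>i. i \<le> n \<Longrightarrow> f i \<in> measurable N (count_space UNIV)"
  shows "{\<omega>\<in>space N. f n \<omega> = x \<and> survives y B (\<lambda>i. f i \<omega>) n} \<in> sets N"
proof -
  have *: "{\<omega>\<in>space N. f i \<omega> \<in> A} \<in> sets N" if "i \<le> n" for i A
    using measurable_sets[OF assms[OF that], of A] by (simp add: vimage_def Int_def conj_commute)
  have "{\<omega>\<in>space N. f i \<omega> \<in> B \<longrightarrow> f (Suc i) \<omega> \<noteq> y} \<in> sets N" if "i \<in> {..<n}" for i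
    using *[of i B] *[of "Suc i" "- {y}"] that by (intro sets.sets_Collect_imp) auto
  then have "{\<omega>\<in>space N. \<forall>i\<in>{..<n}. f i \<omega> \<in> B \<longrightarrow> f (Suc i) \<omega> \<noteq> y} \<in> sets N"
    by (intro sets.sets_Collect_finite_All) auto
  then have "{\<omega>\<in>space N. f n \<omega> \<in> {x}} \<inter> {\<omega>\<in>space N. \<forall>i\<in>{..<n}. f i \<omega> \<in> B \<longrightarrow> f (Suc i) \<omega> \<noteq> y} \<in> sets N"
    by (intro sets.Int *) simp_all
  also have "{\<omega>\<in>space N. f n \<omega> \<in> {x}} \<inter> {\<omega>\<in>space N. \<forall>i\<in>{..<n}. f i \<omega> \<in> B \<longrightarrow> f (Suc i) \<omega> \<noteq> y}
      = {\<omega>\<in>space N. f n \<omega> = x \<and> survives y B (\<lambda>i. f i \<omega>) n}"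
    by (auto simp: survives_def)
  finally show ?thesis .
qed

text \<open>The event that the killed walk is alive and at \<open>x\<close> at time
  \<open>n\<close>; summing the probabilities over \<open>n\<close> gives its occupation
  measure.\<close>

definition occupied :: "int \<Rightarrow> int set \<Rightarrow> nat \<Rightarrow> int \<Rightarrow> 'w set" where
  "occupied y B n x = {\<omega>\<in>space M. X y n \<omega> = x \<and> survives y B (\<lambda>i. X y i \<omega>) n}"

lemma sets_occupied: "occupied y B n x \<in> sets M"
  unfolding occupied_def by (rule sets_survives) (rule measurable_osc_walk)

lemma increment_law:
  "prob {\<omega>\<in>space M. x + (if x \<le> -1 then \<xi> (Suc n) \<omega> else \<xi>' (Suc n) \<omega>) \<in> S}
    = measure_pmf.prob (osc_step \<mu> \<mu>' x) S"
proof (cases "x \<le> -1")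
  case True
  have "measure_pmf.prob (osc_step \<mu> \<mu>' x) S = measure (distr M (count_space UNIV) (\<xi> (Suc n))) ((+) x -` S)"
    using True by (simp add: osc_step_def law)
  also have "\<dots> = prob (\<xi> (Suc n) -` ((+) x -` S) \<inter> space M)"
    by (rule measure_distr) (auto intro: measurable_increments)
  finally show ?thesis using True by (simp add: vimage_def Int_def conj_commute)
next
  case False
  have "measure_pmf.prob (osc_step \<mu> \<mu>' x) S = measure (distr M (count_space UNIV) (\<xi>' (Suc n))) ((+) x -` S)"
    using False by (simp add: osc_step_def law')
  also have "\<dots> = prob (\<xi>' (Suc n) -` ((+) x -` S) \<inter> space M)"
    by (rule measure_distr) (auto intro: measurable_increments)
  finally show ?thesis using False by (simp add: vimage_def Int_def conj_commute)
qed

text \<open>The Markov property of the killed walk: \<open>occupied y B n x\<close> depends only on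
  the increments up to time \<open>n\<close>, and the next move from \<open>x\<close> only on the
  increment at time \<open>Suc n\<close>.\<close>

lemma markov_step:
  "emeasure M {\<omega>\<in>occupied y B n x. X y (Suc n) \<omega> \<in> S}
    = emeasure M (occupied y B n x) * emeasure (osc_step \<mu> \<mu>' x) S"
proof -
  let ?C = "\<lambda>_ :: nat. count_space UNIV :: (int \<times> int) measure"
  let ?H = "PiM {1..n} ?C" and ?N = "PiM {Suc n} ?C"
  let ?Y = "\<lambda>A \<omega>. restrict (\<lambda>i. (\<xi> i \<omega>, \<xi>' i \<omega>)) A"
  \<comment> \<open>The same walk read as a function of the vector of increments, so that events of
    the walk become preimages of measurable sets in a product space.\<close>
  define W where "W = osc_walk (\<lambda>i h. fst (h i :: int \<times> int)) (\<lambda>i h. snd (h i))"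
  have W_eq: "W y m (?Y {1..n} \<omega>) = X y m \<omega>" if "m \<le> n" for m \<omega>
    using that by (induction m) (auto simp: W_def)
  have W_meas: "W y m \<in> measurable ?H (count_space UNIV)" if "m \<le> n" for m
    using that
  proof (induction m)
    case (Suc m)
    then have "(\<lambda>h. h (Suc m)) \<in> measurable ?H (count_space UNIV)"
      by (intro measurable_component_singleton) auto
    from measurable_count_space_apply2[OF Suc.IH this, of "\<lambda>x p. x + (if x \<le> -1 then fst p else snd p)"] Suc.prems
    show ?case by (simp add: W_def)
  next
    case 0
    have "W y 0 = (\<lambda>_. y)" by (simp add: W_def fun_eq_iff)
    then show ?case by simp
  qed
  define E where "E = {h\<in>space ?H. W y n h = x \<and> survives y B (\<lambda>i. W y i h) n}"
  define G where "G = {h\<in>space ?N. x + (if x \<le> -1 then fst (h (Suc n)) else snd (h (Suc n))) \<in> S}"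
  have E: "E \<in> sets ?H" unfolding E_def by (rule sets_survives) (rule W_meas)
  have G: "G \<in> sets ?N"
  proof -
    have "(\<lambda>h. h (Suc n)) \<in> measurable ?N (count_space UNIV)"
      by (intro measurable_component_singleton) auto
    from measurable_sets[OF this, of "{p. x + (if x \<le> -1 then fst p else snd p) \<in> S}"]
    show ?thesis by (simp add: G_def vimage_def Int_def conj_commute)
  qed
  have ind: "indep_var ?H (?Y {1..n}) ?N (?Y {Suc n})"
    by (rule indep_var_restrict[OF indep]) auto
  have surv: "survives y B (\<lambda>i. W y i (?Y {1..n} \<omega>)) n \<longleftrightarrow> survives y B (\<lambda>i. X y i \<omega>) n" for \<omega>
  proof -
    define R where "R = ?Y {1..n} \<omega>"
    have "W y m R = X y m \<omega>" if "m \<le> n" for m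
      unfolding R_def using that by (rule W_eq)
    then show ?thesis
      unfolding R_def[symmetric] by (simp add: survives_def del: osc_walk.simps)
  qed
  have space: "?Y {1..n} \<omega> \<in> space ?H" "?Y {Suc n} \<omega> \<in> space ?N" for \<omega>
    by (simp_all add: space_PiM)
  have 1: "?Y {1..n} -` E \<inter> space M = occupied y B n x"
    unfolding E_def occupied_def
    by (rule set_eqI) (simp only: vimage_eq Int_iff mem_Collect_eq surv W_eq[OF order_refl] space simp_thms conj_ac)
  have 2: "?Y {Suc n} -` G \<inter> space M
      = {\<omega>\<in>space M. x + (if x \<le> -1 then \<xi> (Suc n) \<omega> else \<xi>' (Suc n) \<omega>) \<in> S}"
    unfolding G_def
    by (rule set_eqI) (simp only: vimage_eq Int_iff mem_Collect_eq restrict_apply' singletonI fst_conv snd_conv space simp_thms conj_ac)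
  have "(\<lambda>\<omega>. (?Y {1..n} \<omega>, ?Y {Suc n} \<omega>)) -` (E \<times> G) \<inter> space M
      = (?Y {1..n} -` E \<inter> space M) \<inter> (?Y {Suc n} -` G \<inter> space M)"
    by auto
  \<comment> \<open>On \<open>occupied y B n x\<close> the walk is at \<open>x\<close>, so the side
    of \<open>x\<close> selects the increment actually used.\<close>
  also have "\<dots> = {\<omega>\<in>occupied y B n x. X y (Suc n) \<omega> \<in> S}"
    unfolding 1 2 by (auto simp: occupied_def)
  finally have "prob {\<omega>\<in>occupied y B n x. X y (Suc n) \<omega> \<in> S}
      = prob (occupied y B n x) * measure_pmf.prob (osc_step \<mu> \<mu>' x) S"
    using indep_varD[OF ind E G] unfolding 1 2 increment_law by simp
  then show ?thesis
    by (simp add: emeasure_eq_measure measure_pmf.emeasure_eq_measure ennreal_mult)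
qed

lemma sets_osc_walk: "X y m -` S \<inter> space M \<in> sets M"
  by (rule measurable_sets[OF measurable_osc_walk]) simp

lemma sets_occupied_Suc: "{\<omega>\<in>occupied y B n x. X y (Suc n) \<omega> \<in> S} \<in> sets M"
proof -
  have "{\<omega>\<in>occupied y B n x. X y (Suc n) \<omega> \<in> S} = occupied y B n x \<inter> (X y (Suc n) -` S \<inter> space M)"
    by (auto simp: occupied_def simp del: osc_walk.simps)
  then show ?thesis using sets_occupied sets_osc_walk by (metis sets.Int)
qed

text \<open>Events with different \<open>x\<close> are disjoint because \<open>x\<close> is the
  position at time \<open>n\<close>. The target set may depend on \<open>x\<close>, so the formula
  yields both the recursion for the occupation and the probability of a crossing.\<close>

lemma emeasure_occupied_step:
  "emeasure M (\<Union>x. {\<omega>\<in>occupied y B n x. X y (Suc n) \<omega> \<in> S x})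
    = (\<integral>\<^sup>+x. emeasure M (occupied y B n x) * emeasure (osc_step \<mu> \<mu>' x) (S x) \<partial>count_space UNIV)"
  unfolding markov_step[symmetric]
proof (rule emeasure_UN_countable)
  show "disjoint_family_on (\<lambda>x. {\<omega>\<in>occupied y B n x. X y (Suc n) \<omega> \<in> S x}) UNIV"
    by (auto simp: disjoint_family_on_def occupied_def)
qed (rule sets_occupied_Suc, simp)

lemma emeasure_occupied_0: "emeasure M (occupied y B 0 x) = indicator {y} x"
  by (simp add: occupied_def survives_def indicator_def emeasure_space_1)

lemma emeasure_occupied_Suc:
  "emeasure M (occupied y B (Suc n) z) = (\<integral>\<^sup>+x. emeasure M (occupied y B n x)
     * pmf (osc_step \<mu> \<mu>' x) z * (if z = y \<and> x \<in> B then 0 else 1) \<partial>count_space UNIV)"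
proof -
  \<comment> \<open>A killing transition is encoded by an empty target set.\<close>
  have eq: "occupied y B (Suc n) z
      = (\<Union>x. {\<omega>\<in>occupied y B n x. X y (Suc n) \<omega> \<in> (if z = y \<and> x \<in> B then {} else {z})})"
    by (auto simp: occupied_def survives_def less_Suc_eq simp del: osc_walk.simps split: if_splits)
  show ?thesis
    unfolding eq emeasure_occupied_step
    by (intro nn_integral_cong) (auto simp: emeasure_pmf_single)
qed

lemma emeasure_survives_crosses:
  "emeasure M {\<omega>\<in>space M. crosses (\<lambda>i. X y i \<omega>) n \<and> survives y B (\<lambda>i. X y i \<omega>) n}
    = (\<integral>\<^sup>+x. emeasure M (occupied y B n x) * emeasure (osc_step \<mu> \<mu>' x) (opposite x) \<partial>count_space UNIV)"
  and sets_survives_crosses: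
  "{\<omega>\<in>space M. crosses (\<lambda>i. X y i \<omega>) n \<and> survives y B (\<lambda>i. X y i \<omega>) n} \<in> sets M"
proof -
  have eq: "{\<omega>\<in>space M. crosses (\<lambda>i. X y i \<omega>) n \<and> survives y B (\<lambda>i. X y i \<omega>) n}
      = (\<Union>x. {\<omega>\<in>occupied y B n x. X y (Suc n) \<omega> \<in> opposite x})"
    by (auto simp: occupied_def crosses_def simp del: osc_walk.simps)
  show "emeasure M {\<omega>\<in>space M. crosses (\<lambda>i. X y i \<omega>) n \<and> survives y B (\<lambda>i. X y i \<omega>) n}
    = (\<integral>\<^sup>+x. emeasure M (occupied y B n x) * emeasure (osc_step \<mu> \<mu>' x) (opposite x) \<partial>count_space UNIV)"
    unfolding eq by (rule emeasure_occupied_step)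
  show "{\<omega>\<in>space M. crosses (\<lambda>i. X y i \<omega>) n \<and> survives y B (\<lambda>i. X y i \<omega>) n} \<in> sets M"
    unfolding eq by (intro sets.countable_UN') (auto simp: sets_occupied_Suc simp del: osc_walk.simps)
qed

section \<open>The expected number of crossings up to killing\<close>

definition crossings :: "int \<Rightarrow> int set \<Rightarrow> 'w \<Rightarrow> ennreal" where
  "crossings y B \<omega> = (\<Sum>n. indicator {n. crosses (\<lambda>i. X y i \<omega>) n \<and> survives y B (\<lambda>i. X y i \<omega>) n} n)"

lemma borel_measurable_indicator_crosses:
  "(\<lambda>\<omega>. indicator {n. crosses (\<lambda>i. X y i \<omega>) n \<and> survives y B (\<lambda>i. X y i \<omega>) n} n :: ennreal)
    \<in> borel_measurable M"
proof -
  have "indicator {\<omega>\<in>space M. crosses (\<lambda>i. X y i \<omega>) n \<and> survives y B (\<lambda>i. X y i \<omega>) n}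
      \<in> borel_measurable M"
    using sets_survives_crosses by (rule borel_measurable_indicator)
  then show ?thesis
    by (rule measurable_cong[THEN iffD1, rotated]) (simp add: indicator_def)
qed

lemma borel_measurable_crossings: "crossings y B \<in> borel_measurable M"
  unfolding crossings_def[abs_def]
  by (rule borel_measurable_suminf_order) (rule borel_measurable_indicator_crosses)

text \<open>The expected count integrates the probability of crossing from \<open>x\<close> against
  the occupation measure of the killed walk. Multiplied by the flow into \<open>y\<close> from
  \<open>B\<close>, that measure is at most \<open>osc_measure\<close> by
  \<open>killed_occupation_le\<close>.\<close>

lemma expected_crossings_le:
  "(\<integral>\<^sup>+x. indicator B x * osc_measure \<mu> \<mu>' x * pmf (osc_step \<mu> \<mu>' x) y \<partial>count_space UNIV)
    * (\<integral>\<^sup>+\<omega>. crossings y B \<omega> \<partial>M) \<le> crossing_flow \<mu> \<mu>'" (is "?w * _ \<le> _")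
proof -
  have "(\<integral>\<^sup>+\<omega>. crossings y B \<omega> \<partial>M)
      = (\<Sum>n. \<integral>\<^sup>+\<omega>. indicator {n. crosses (\<lambda>i. X y i \<omega>) n \<and> survives y B (\<lambda>i. X y i \<omega>) n} n \<partial>M)"
    unfolding crossings_def by (rule nn_integral_suminf) (rule borel_measurable_indicator_crosses)
  also have "\<dots> = (\<Sum>n. emeasure M {\<omega>\<in>space M. crosses (\<lambda>i. X y i \<omega>) n \<and> survives y B (\<lambda>i. X y i \<omega>) n})"
  proof (intro suminf_cong)
    fix n
    let ?S = "{\<omega>\<in>space M. crosses (\<lambda>i. X y i \<omega>) n \<and> survives y B (\<lambda>i. X y i \<omega>) n}"
    have "(\<integral>\<^sup>+\<omega>. indicator {n. crosses (\<lambda>i. X y i \<omega>) n \<and> survives y B (\<lambda>i. X y i \<omega>) n} n \<partial>M)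
        = (\<integral>\<^sup>+\<omega>. indicator ?S \<omega> \<partial>M)"
      by (rule nn_integral_cong) (simp add: indicator_def)
    also have "\<dots> = emeasure M ?S"
      by (rule nn_integral_indicator) (rule sets_survives_crosses)
    finally show "(\<integral>\<^sup>+\<omega>. indicator {n. crosses (\<lambda>i. X y i \<omega>) n \<and> survives y B (\<lambda>i. X y i \<omega>) n} n \<partial>M)
        = emeasure M ?S" .
  qed
  also have "\<dots> = (\<integral>\<^sup>+x. (\<Sum>n. emeasure M (occupied y B n x)) * emeasure (osc_step \<mu> \<mu>' x) (opposite x) \<partial>count_space UNIV)"
    unfolding emeasure_survives_crosses by (subst nn_integral_suminf[symmetric]) auto
  finally have "?w * (\<integral>\<^sup>+\<omega>. crossings y B \<omega> \<partial>M)
      = (\<integral>\<^sup>+x. ?w * (\<Sum>n. emeasure M (occupied y B n x)) * emeasure (osc_step \<mu> \<mu>' x) (opposite x) \<partial>count_space UNIV)"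
    by (simp add: nn_integral_cmult mult.assoc)
  also have "\<dots> \<le> crossing_flow \<mu> \<mu>'"
    unfolding crossing_flow_def
    by (intro nn_integral_mono mult_right_mono killed_occupation_le osc_measure_invariant supp
        emeasure_occupied_0 emeasure_occupied_Suc) auto
  finally show ?thesis .
qed

lemma AE_attracted: "AE \<omega> in M. attracted (\<lambda>n. X y n \<omega>)"
proof -
  have "AE \<omega> in M. 0 < \<xi> (Suc n) \<omega> \<and> \<xi>' (Suc n) \<omega> < 0" for n
  proof -
    have "AE k in distr M (count_space UNIV) (\<xi> (Suc n)). 0 < k"
      using supp by (subst law) (auto intro!: AE_pmfI)
    moreover have "AE j in distr M (count_space UNIV) (\<xi>' (Suc n)). j < 0"
      using supp by (subst law') (auto intro!: AE_pmfI)
    ultimately show ?thesis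
      using measurable_increments[of "Suc n"] by (simp add: AE_distr_iff)
  qed
  then have "AE \<omega> in M. \<forall>n. 0 < \<xi> (Suc n) \<omega> \<and> \<xi>' (Suc n) \<omega> < 0"
    by (simp add: AE_all_countable)
  then show ?thesis by eventually_elim (simp add: attracted_def)
qed

section \<open>Recurrence of the crossing sub-process and of the walk\<close>

text \<open>With \<open>B = opposite y\<close> the weight in \<open>expected_crossings_le\<close> is
  \<open>rho_mass\<close> at \<open>y\<close>, which is nonzero on the crossing class; a finite
  product then forces a finite expected number of crossings.\<close>

lemma positive_recurrent_crossing:
  assumes "crossing_flow \<mu> \<mu>' < \<infinity>" "y \<in> crossing_class \<mu> \<mu>'"
  shows "positive_recurrent_state M (crossing_walk \<xi> \<xi>') y"
proof -
  have "(\<integral>\<^sup>+\<omega>. ennreal_of_enat (return_time (\<lambda>n. crossing_walk \<xi> \<xi>' y n \<omega>) y) \<partial>M)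
      \<le> (\<integral>\<^sup>+\<omega>. crossings y (opposite y) \<omega> \<partial>M)"
    by (rule nn_integral_mono_AE, use AE_attracted[of y] in eventually_elim)
      (unfold crossing_walk_def crossings_def, rule crossing_return_time_le)
  also have "\<dots> < \<infinity>"
  proof -
    have "rho_mass \<mu> \<mu>' y * (\<integral>\<^sup>+\<omega>. crossings y (opposite y) \<omega> \<partial>M) < \<infinity>"
      using expected_crossings_le[where B = "opposite y" and y = y] assms(1)
      by (simp add: rho_mass_eq_flow[OF supp])
    moreover have "rho_mass \<mu> \<mu>' y \<noteq> 0"
      using assms(2) by (simp add: rho_mass_eq_0_iff[OF supp])
    ultimately show ?thesis by (auto simp: ennreal_mult_less_top)
  qed
  finally show ?thesis unfolding positive_recurrent_state_def .
qed

text \<open>With \<open>B = UNIV\<close> invariance makes the weight \<open>osc_measure\<close> at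
  \<open>y\<close>, nonzero on the essential class. The number of crossings before returning is then
  almost surely finite, which excludes paths that never return.\<close>

lemma recurrent_walk:
  assumes "crossing_flow \<mu> \<mu>' < \<infinity>" "y \<in> ess_class \<mu> \<mu>'"
  shows "recurrent_state M X y"
proof -
  have "osc_measure \<mu> \<mu>' y * (\<integral>\<^sup>+\<omega>. crossings y UNIV \<omega> \<partial>M) < \<infinity>"
    using expected_crossings_le[where B = UNIV and y = y] assms(1)
    by (simp add: osc_measure_invariant[OF supp])
  moreover have "osc_measure \<mu> \<mu>' y \<noteq> 0"
    using assms(2) by (simp add: osc_measure_eq_0_iff[OF supp])
  ultimately have "(\<integral>\<^sup>+\<omega>. crossings y UNIV \<omega> \<partial>M) \<noteq> \<infinity>" by (auto simp: ennreal_mult_less_top)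
  then have "AE \<omega> in M. crossings y UNIV \<omega> \<noteq> \<infinity>"
    by (rule nn_integral_PInf_AE[OF borel_measurable_crossings])
  with AE_attracted[of y] show ?thesis
    unfolding recurrent_state_def
  proof eventually_elim
    case (elim \<omega>)
    then show ?case
      using crossings_infinite_if_no_return[of "\<lambda>n. X y n \<omega>" y] unfolding crossings_def by auto
  qed
qed

end

theorem proposition4p3:
  fixes \<mu> \<mu>' :: "int pmf"
    and M :: "'w measure"
    and \<xi> \<xi>' :: "nat \<Rightarrow> 'w \<Rightarrow> int"
  assumes supp: "set_pmf \<mu> \<subseteq> {0<..}" "set_pmf \<mu>' \<subseteq> {..<0}"
    and gcd: "Gcd (set_pmf \<mu>) = 1" "Gcd (set_pmf \<mu>') = 1"
    and M: "prob_space M"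
    and indep: "prob_space.indep_vars M (\<lambda>_. count_space UNIV) (\<lambda>n \<omega>. (\<xi> n \<omega>, \<xi>' n \<omega>)) {1..}"
    and ident: "\<And>n. n \<ge> 1 \<Longrightarrow>
           distr M (count_space UNIV) (\<lambda>\<omega>. (\<xi> n \<omega>, \<xi>' n \<omega>))
         = distr M (count_space UNIV) (\<lambda>\<omega>. (\<xi> 1 \<omega>, \<xi>' 1 \<omega>))"
    and law: "\<And>n. n \<ge> 1 \<Longrightarrow> distr M (count_space UNIV) (\<xi> n) = measure_pmf \<mu>"
    and law': "\<And>n. n \<ge> 1 \<Longrightarrow> distr M (count_space UNIV) (\<xi>' n) = measure_pmf \<mu>'"
  shows "(emeasure (rho \<mu> \<mu>') (crossing_class \<mu> \<mu>') < \<infinity>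
            \<longleftrightarrow> summable (\<lambda>n. upper_tail \<mu> n * lower_tail \<mu>' n))
       \<and> (summable (\<lambda>n. upper_tail \<mu> n * lower_tail \<mu>' n) \<longrightarrow>
            (\<forall>y\<in>crossing_class \<mu> \<mu>'. positive_recurrent_state M (crossing_walk \<xi> \<xi>') y)
          \<and> (\<forall>y\<in>ess_class \<mu> \<mu>'. recurrent_state M (osc_walk \<xi> \<xi>') y))"
proof -
  interpret oscillating_walk M \<mu> \<mu>' \<xi> \<xi>'
    by (intro oscillating_walk.intro oscillating_walk_axioms.intro M supp indep law law')
  show ?thesis
    using positive_recurrent_crossing recurrent_walk
    by (simp only: emeasure_rho_crossing_class[OF supp] crossing_flow_finite_iff) blast
qed

end
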